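(* Let $A\in\mathbb{R}^{n\times n}$, $B\in\mathbb{R}^{n\times m}$ with $(A,B)$ controllable, and let $u_d(0),\dots,u_d(T-1)\in\mathbb{R}^m$ and $x_d(0),\dots,x_d(T)\in\mathbb{R}^n$ be data satisfying $x_d(k+1)=Ax_d(k)+Bu_d(k)$ for $k=0,\dots,T-1$. Let $U_{0,1,T}$, $X_{0,T}$, $X_{1,T}$ be the data matrices defined in the context, and suppose that $$\operatorname{rank}\begin{bmatrix}U_{0,1,T}\\ X_{0,T}\end{bmatrix}=n+m .$$ Then any matrix $Q\in\mathbb{R}^{T\times n}$ satisfying $$\begin{bmatrix}X_{0,T}Q & X_{1,T}Q\\ Q^\top X_{1,T}^\top & X_{0,T}Q\end{bmatrix}\succ 0 \qquad (\ast)$$ is such that $$K=U_{0,1,T}\,Q\,(X_{0,T}Q)^{-1}\qquad(\ast\ast)$$ stabilizes the system $x(k+1)=Ax(k)+Bu(k)$. Conversely, if $K\in\mathbb{R}^{m\times n}$ is a stabilizing state-feedback gain for this system, then it can be written as in $(\ast\ast)$ for some $Q$ that is a solution of $(\ast)$.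
   Context: Data matrices: $U_{0,1,T}=[u_d(0)\ u_d(1)\ \cdots\ u_d(T-1)]\in\mathbb{R}^{m\times T}$, $X_{0,T}=[x_d(0)\ x_d(1)\ \cdots\ x_d(T-1)]\in\mathbb{R}^{n\times T}$, $X_{1,T}=[x_d(1)\ x_d(2)\ \cdots\ x_d(T)]\in\mathbb{R}^{n\times T}$. The notation $M\succ0$ means that $M$ is symmetric and positive definite (so $(\ast)$ includes the requirement that $X_{0,T}Q$ be symmetric). A gain $K$ stabilizes the system (is a stabilizing state-feedback gain) if the closed-loop system with $u=Kx$ is asymptotically stable, i.e. all eigenvalues of $A+BK$ have modulus strictly less than $1$. *)

theory Defs
  imports "Jordan_Normal_Form.DL_Rank" "Jordan_Normal_Form.Spectral_Radius"
begin

text \<open>Matrices and vectors are those of \<^theory>\<open>Jordan_Normal_Form.Matrix\<close>, whose dimensions are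
  natural numbers fixed by carrier assumptions.\<close>

definition data_mat :: "nat \<Rightarrow> (nat \<Rightarrow> real vec) \<Rightarrow> nat \<Rightarrow> nat \<Rightarrow> real mat" where
  "data_mat d z i T = mat_of_cols d (map z [i..<i + T])"

definition pos_def_mat :: "real mat \<Rightarrow> bool" where
  "pos_def_mat M \<longleftrightarrow> square_mat M \<and> transpose_mat M = M \<and>
     (\<forall>v \<in> carrier_vec (dim_row M). v \<noteq> 0\<^sub>v (dim_row M) \<longrightarrow> v \<bullet> (M *\<^sub>v v) > 0)"

primrec sys_state :: "real mat \<Rightarrow> real mat \<Rightarrow> real vec \<Rightarrow> (nat \<Rightarrow> real vec) \<Rightarrow> nat \<Rightarrow> real vec" where
  "sys_state A B x0 u 0 = x0"
| "sys_state A B x0 u (Suc k) = A *\<^sub>v sys_state A B x0 u k + B *\<^sub>v u k"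

text \<open>Any state can be steered to any other state in finitely many steps. For discrete time this is
  stronger than controllability to the origin, and it is the notion equivalent to the Kalman rank
  condition for the pair \<open>(A, B)\<close>.\<close>

definition controllable :: "real mat \<Rightarrow> real mat \<Rightarrow> bool" where
  "controllable A B \<longleftrightarrow>
     (\<forall>x0 \<in> carrier_vec (dim_row A). \<forall>x1 \<in> carrier_vec (dim_row A).
        \<exists>N u. (\<forall>k < N. u k \<in> carrier_vec (dim_col B)) \<and> sys_state A B x0 u N = x1)"

text \<open>Real matrices are embedded into the complex ones so that all eigenvalues are taken into
  account, not only the real ones.\<close>

definition stabilizing :: "real mat \<Rightarrow> real mat \<Rightarrow> real mat \<Rightarrow> bool" where
  "stabilizing A B K \<longleftrightarrow>
     (\<forall>z. eigenvalue (map_mat complex_of_real (A + B * K)) z \<longrightarrow> cmod z < 1)"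

definition data_lmi :: "real mat \<Rightarrow> real mat \<Rightarrow> real mat \<Rightarrow> bool" where
  "data_lmi X0 X1 Q \<longleftrightarrow>
     pos_def_mat (four_block_mat (X0 * Q)                              (X1 * Q)
                                 (transpose_mat Q * transpose_mat X1)  (X0 * Q))"

end

theory Submission
  imports Defs
begin

text \<open>Put \<open>S = X0 * Q\<close> and \<open>F = A + B * K\<close>. The data equation \<open>X1 = A * X0 + B * U\<close> turns
  \<open>K * S = U * Q\<close> into \<open>X1 * Q = F * S\<close>, so by completing the square the matrix inequality is
  equivalent to \<open>S \<succ> 0\<close> and \<open>S - F * S * F\<^sup>T \<succ> 0\<close>. Evaluating these forms at the real and
  imaginary parts of an eigenvector of \<open>F\<^sup>T\<close> gives stability. Conversely, if \<open>F\<close> is stable then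
  a sufficiently long partial sum of \<open>\<Sum>i. F ^ i * (F\<^sup>T) ^ i\<close> is a suitable \<open>S\<close>, and the rank
  condition yields \<open>Q\<close> with \<open>U * Q = K * S\<close> and \<open>X0 * Q = S\<close>.\<close>

section \<open>Positive definite matrices\<close>

lemma pos_def_mat_iff:
  assumes "M \<in> carrier_mat n n"
  shows "pos_def_mat M \<longleftrightarrow> transpose_mat M = M \<and>
    (\<forall>v \<in> carrier_vec n. v \<noteq> 0\<^sub>v n \<longrightarrow> v \<bullet> (M *\<^sub>v v) > 0)"
  using assms by (auto simp: pos_def_mat_def)

lemma pos_def_mat_nonneg:
  assumes "pos_def_mat M" and "M \<in> carrier_mat n n" and "v \<in> carrier_vec n"
  shows "v \<bullet> (M *\<^sub>v v) \<ge> 0"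
proof (cases "v = 0\<^sub>v n")
  case True
  then show ?thesis using assms(2) by simp
next
  case False
  then show ?thesis using assms pos_def_mat_iff[OF assms(2)] by fastforce
qed

lemma pos_def_mat_one: "pos_def_mat (1\<^sub>m n)"
proof -
  have "v \<bullet> v > 0" if "v \<in> carrier_vec n" "v \<noteq> 0\<^sub>v n" for v :: "real vec"
  proof -
    have "\<exists>i<n. v $ i \<noteq> 0"
    proof (rule ccontr)
      assume "\<not> (\<exists>i<n. v $ i \<noteq> 0)"
      then have "v = 0\<^sub>v n" using that(1) by (intro eq_vecI) auto
      with that(2) show False by simp
    qed
    then obtain i where i: "i < n" "v $ i \<noteq> 0" by blast
    then have "0 < (\<Sum>i = 0..<n. v $ i * v $ i)"
      by (intro sum_pos2[of _ i]) (auto simp: zero_less_mult_iff linorder_neq_iff)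
    then show ?thesis using that by (simp add: scalar_prod_def)
  qed
  then show ?thesis by (simp add: pos_def_mat_iff[of _ n])
qed

text \<open>Vectors padded with zeros see only the block \<open>P\<close>, and padding keeps a
  nonzero vector nonzero.\<close>

lemma pos_def_mat_upper_left_block:
  assumes P: "P \<in> carrier_mat n n" and E: "E \<in> carrier_mat n k"
    and G: "G \<in> carrier_mat k n" and D: "D \<in> carrier_mat k k"
    and pd: "pos_def_mat (four_block_mat P E G D)" (is "pos_def_mat ?M")
  shows "pos_def_mat P"
proof -
  have M: "?M \<in> carrier_mat (n + k) (n + k)" using P D by simp
  have "transpose_mat P = P"
  proof (rule eq_matI)
    fix i j assume ij: "i < dim_row P" "j < dim_col P"
    have "transpose_mat ?M $$ (i, j) = ?M $$ (i, j)" using pd by (simp add: pos_def_mat_def)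
    then show "transpose_mat P $$ (i, j) = P $$ (i, j)" using ij P D by simp
  qed (use P in auto)
  moreover have "0 < v \<bullet> (P *\<^sub>v v)" if v: "v \<in> carrier_vec n" "v \<noteq> 0\<^sub>v n" for v
  proof -
    have z: "(0\<^sub>v k :: real vec) \<in> carrier_vec k" by simp
    have "0\<^sub>v (n + k) = (0\<^sub>v n :: real vec) @\<^sub>v 0\<^sub>v k" by auto
    then have "v @\<^sub>v 0\<^sub>v k \<noteq> 0\<^sub>v (n + k)"
      using append_vec_eq[OF v(1), of "0\<^sub>v n" "0\<^sub>v k" "0\<^sub>v k"] v(2) by simp
    then have "0 < (v @\<^sub>v 0\<^sub>v k) \<bullet> (?M *\<^sub>v (v @\<^sub>v 0\<^sub>v k))"
      using pd append_carrier_vec[OF v(1) z] unfolding pos_def_mat_iff[OF M] by blast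
    also have "E *\<^sub>v 0\<^sub>v k = 0\<^sub>v n" using E by (intro eq_vecI) auto
    then have "(v @\<^sub>v 0\<^sub>v k) \<bullet> (?M *\<^sub>v (v @\<^sub>v 0\<^sub>v k)) = v \<bullet> (P *\<^sub>v v)"
      using P E G D v unfolding four_block_mat_mult_vec[OF P E G D v(1) z]
      by (subst scalar_prod_append[of _ n _ k]) auto
    finally show ?thesis .
  qed
  ultimately show ?thesis by (simp add: pos_def_mat_iff[OF P])
qed

text \<open>A nonzero kernel vector would have quadratic form 0, so the determinant is nonzero. The
  conclusion speaks of \<open>mat_inverse\<close> because the theorem expresses the inverse of
  \<open>X0 * Q\<close> that way.\<close>

lemma pos_def_mat_imp_mat_inverse:
  assumes S: "S \<in> carrier_mat n n" and pd: "pos_def_mat S"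
  obtains P where "mat_inverse S = Some P" "P \<in> carrier_mat n n"
    "S * P = 1\<^sub>m n" "P * S = 1\<^sub>m n"
proof -
  have "det S \<noteq> 0"
  proof
    assume "det S = 0"
    then obtain v where v: "v \<in> carrier_vec n" "v \<noteq> 0\<^sub>v n" "S *\<^sub>v v = 0\<^sub>v n"
      using det_0_iff_vec_prod_zero[OF S] by blast
    then have "v \<bullet> (S *\<^sub>v v) = 0" by simp
    with v(1,2) pd show False unfolding pos_def_mat_iff[OF S] by fastforce
  qed
  then have "S \<in> Units (ring_mat TYPE(real) n ())"
    by (rule det_non_zero_imp_unit[OF S])
  then obtain P where P: "mat_inverse S = Some P"
    using mat_inverse(1)[OF S, of "()"] by (cases "mat_inverse S") auto
  from that[OF P] mat_inverse(2)[OF S P] show thesis by blast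
qed

section \<open>Quadratic forms under congruence, and the Schur complement\<close>

lemma quadratic_form_congruence:
  fixes F S :: "real mat"
  assumes F: "F \<in> carrier_mat n k" and S: "S \<in> carrier_mat k k" and v: "v \<in> carrier_vec n"
  shows "v \<bullet> ((F * S * transpose_mat F) *\<^sub>v v) =
    (transpose_mat F *\<^sub>v v) \<bullet> (S *\<^sub>v (transpose_mat F *\<^sub>v v))"
proof -
  have Ft: "transpose_mat F \<in> carrier_mat k n" using F by simp
  have "(F * S * transpose_mat F) *\<^sub>v v = F *\<^sub>v (S *\<^sub>v (transpose_mat F *\<^sub>v v))"
    using F Ft S v by (simp add: assoc_mult_mat_vec[of _ n k _ n] assoc_mult_mat_vec[of _ n k _ k])
  then show ?thesis
    using transpose_vec_mult_scalar[OF F _ v, of "S *\<^sub>v (transpose_mat F *\<^sub>v v)"] S Ft v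
    by (simp add: mult_mat_vec_carrier)
qed

text \<open>The matrix is the Stein (discrete Lyapunov) operator applied to \<open>S\<close>: the
  congruence moves \<open>F\<close> onto the argument, so its form is the drop of the energy given
  by \<open>S\<close> along one step of \<open>F^T\<close>.\<close>

lemma quadratic_form_stein:
  fixes F S :: "real mat"
  assumes F: "F \<in> carrier_mat n n" and S: "S \<in> carrier_mat n n" and v: "v \<in> carrier_vec n"
  shows "v \<bullet> ((S - F * S * transpose_mat F) *\<^sub>v v) = v \<bullet> (S *\<^sub>v v) -
    (transpose_mat F *\<^sub>v v) \<bullet> (S *\<^sub>v (transpose_mat F *\<^sub>v v))"
proof -
  have C: "F * S * transpose_mat F \<in> carrier_mat n n" using F S by simp
  then have "v \<bullet> ((S - F * S * transpose_mat F) *\<^sub>v v) =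
      v \<bullet> (S *\<^sub>v v) - v \<bullet> ((F * S * transpose_mat F) *\<^sub>v v)"
    using S v mult_mat_vec_carrier[OF C v]
    by (simp add: minus_mult_distrib_mat_vec[OF S C v] scalar_prod_minus_distrib[of _ n]
        del: assoc_mult_mat)
  then show ?thesis by (simp add: quadratic_form_congruence[OF F S v])
qed

lemma transpose_congruence:
  fixes F S :: "real mat"
  assumes F: "F \<in> carrier_mat n k" and S: "S \<in> carrier_mat k k" and sym: "transpose_mat S = S"
  shows "transpose_mat (F * S * transpose_mat F) = F * S * transpose_mat F"
proof -
  have "transpose_mat (F * S * transpose_mat F) = F * transpose_mat (F * S)"
    using F S by (subst transpose_mult[of _ n k _ n]) auto
  also have "\<dots> = F * (S * transpose_mat F)"
    using F S sym by (simp add: transpose_mult[of _ n k])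
  finally show ?thesis using F S by (simp add: assoc_mult_mat[of _ n k _ k _ n])
qed

text \<open>The Schur complement of the lower right block is
  \<open>S - (F * S) * S^-1 * (F * S)^T\<close>, which for symmetric \<open>S\<close> collapses to
  \<open>S - F * S * F^T\<close>. The factor \<open>S\<close> in the off-diagonal blocks lets the
  square be completed without inverting \<open>S\<close>.\<close>

lemma pos_def_block_mat_iff:
  assumes F: "F \<in> carrier_mat n n" and S: "S \<in> carrier_mat n n"
  shows "pos_def_mat (four_block_mat S (F * S) (transpose_mat (F * S)) S) \<longleftrightarrow>
    pos_def_mat S \<and> pos_def_mat (S - F * S * transpose_mat F)" (is "pos_def_mat ?M \<longleftrightarrow> _ \<and> pos_def_mat ?L")
proof -
  let ?Ft = "transpose_mat F"
  have Ft: "?Ft \<in> carrier_mat n n" and FS: "F * S \<in> carrier_mat n n"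
    and FSt: "transpose_mat (F * S) \<in> carrier_mat n n" and L: "?L \<in> carrier_mat n n"
    using F S by auto
  have M: "?M \<in> carrier_mat (n + n) (n + n)" using S by simp
  have symM: "transpose_mat ?M = ?M" if "transpose_mat S = S"
    using that by (simp add: transpose_four_block_mat[OF S FS FSt S])
  have symL: "transpose_mat ?L = ?L" if "transpose_mat S = S"
    using that transpose_congruence[OF F S that] F S
    by (subst transpose_minus[of _ n n]) auto
  \<comment> \<open>Completing the square in the second block variable.\<close>
  have square: "(p @\<^sub>v q) \<bullet> (?M *\<^sub>v (p @\<^sub>v q)) =
      p \<bullet> (?L *\<^sub>v p) + (q + ?Ft *\<^sub>v p) \<bullet> (S *\<^sub>v (q + ?Ft *\<^sub>v p))"
    if sym: "transpose_mat S = S" and p: "p \<in> carrier_vec n" and q: "q \<in> carrier_vec n" for p q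
  proof -
    define g where "g = ?Ft *\<^sub>v p"
    have g: "g \<in> carrier_vec n" using Ft p by (simp add: g_def)
    have car: "S *\<^sub>v p \<in> carrier_vec n" "S *\<^sub>v q \<in> carrier_vec n" "S *\<^sub>v g \<in> carrier_vec n"
      "(F * S) *\<^sub>v q \<in> carrier_vec n" "transpose_mat (F * S) *\<^sub>v p \<in> carrier_vec n"
      "(F * S * ?Ft) *\<^sub>v p \<in> carrier_vec n"
      using F S FS FSt p q g by (auto intro!: mult_mat_vec_carrier)
    \<comment> \<open>Symmetry of \<open>S\<close> merges the two mixed terms of the expanded
      square.\<close>
    have S_comm: "q \<bullet> (S *\<^sub>v g) = g \<bullet> (S *\<^sub>v q)"
      using transpose_vec_mult_scalar[OF S g q] comm_scalar_prod[OF car(2) g] sym by simp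
    have upper: "p \<bullet> ((F * S) *\<^sub>v q) = g \<bullet> (S *\<^sub>v q)"
      using transpose_vec_mult_scalar[OF F car(2) p] F S q by (simp add: g_def)
    have lower: "q \<bullet> (transpose_mat (F * S) *\<^sub>v p) = g \<bullet> (S *\<^sub>v q)"
      using transpose_vec_mult_scalar[OF FS q p] comm_scalar_prod[OF q car(5)] upper by simp
    have "(p @\<^sub>v q) \<bullet> (?M *\<^sub>v (p @\<^sub>v q)) =
        p \<bullet> (S *\<^sub>v p + (F * S) *\<^sub>v q) + q \<bullet> (transpose_mat (F * S) *\<^sub>v p + S *\<^sub>v q)"
      using car p q unfolding four_block_mat_mult_vec[OF S FS FSt S p q]
      by (intro scalar_prod_append[of _ n _ n]) auto
    also have "\<dots> = p \<bullet> (S *\<^sub>v p) + 2 * (g \<bullet> (S *\<^sub>v q)) + q \<bullet> (S *\<^sub>v q)"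
      using car p q upper lower by (simp add: scalar_prod_add_distrib[of _ n])
    also have "\<dots> = p \<bullet> (?L *\<^sub>v p) + (q + g) \<bullet> (S *\<^sub>v (q + g))"
    proof -
      have "p \<bullet> (?L *\<^sub>v p) = p \<bullet> (S *\<^sub>v p) - g \<bullet> (S *\<^sub>v g)"
        unfolding g_def by (rule quadratic_form_stein[OF F S p])
      moreover have "(q + g) \<bullet> (S *\<^sub>v (q + g)) =
          q \<bullet> (S *\<^sub>v q) + 2 * (g \<bullet> (S *\<^sub>v q)) + g \<bullet> (S *\<^sub>v g)"
        using S q g car S_comm
        by (simp add: mult_add_distrib_mat_vec[of _ n n] scalar_prod_add_distrib[of _ n]
            add_scalar_prod_distrib[of _ n])
      ultimately show ?thesis by simp
    qed
    finally show ?thesis by (simp add: g_def)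
  qed
  have Ft_0: "?Ft *\<^sub>v 0\<^sub>v n = 0\<^sub>v n" using F by (intro eq_vecI) auto
  have append_0: "p @\<^sub>v q = 0\<^sub>v (n + n) \<longleftrightarrow> p = 0\<^sub>v n \<and> q = 0\<^sub>v n"
    if "p \<in> carrier_vec n" "q \<in> carrier_vec n" for p q :: "real vec"
  proof -
    have "0\<^sub>v (n + n) = (0\<^sub>v n :: real vec) @\<^sub>v 0\<^sub>v n" by auto
    then show ?thesis using append_vec_eq[of p n "0\<^sub>v n" q "0\<^sub>v n"] that by simp
  qed
  show ?thesis
  proof
    assume pdM: "pos_def_mat ?M"
    then have pdS: "pos_def_mat S" by (rule pos_def_mat_upper_left_block[OF S FS FSt S])
    then have sym: "transpose_mat S = S" by (simp add: pos_def_mat_def)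
    have pos: "0 < p \<bullet> (?L *\<^sub>v p) + (q + ?Ft *\<^sub>v p) \<bullet> (S *\<^sub>v (q + ?Ft *\<^sub>v p))"
      if "p \<in> carrier_vec n" "q \<in> carrier_vec n" "p \<noteq> 0\<^sub>v n \<or> q \<noteq> 0\<^sub>v n" for p q
      using pdM that append_0[of p q] square[OF sym, of p q] unfolding pos_def_mat_iff[OF M]
      by (metis append_carrier_vec)
    \<comment> \<open>With \<open>q = - F^T p\<close> the square vanishes and only the form of the
      complement remains.\<close>
    have "0 < p \<bullet> (?L *\<^sub>v p)" if "p \<in> carrier_vec n" "p \<noteq> 0\<^sub>v n" for p
      using pos[of p "- (?Ft *\<^sub>v p)"] that L Ft S F by (simp add: uminus_l_inv_vec[of _ n])
    then show "pos_def_mat S \<and> pos_def_mat ?L"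
      using pdS sym symL unfolding pos_def_mat_iff[OF L] by simp
  next
    assume pd: "pos_def_mat S \<and> pos_def_mat ?L"
    then have sym: "transpose_mat S = S" by (simp add: pos_def_mat_def)
    have "0 < v \<bullet> (?M *\<^sub>v v)" if v: "v \<in> carrier_vec (n + n)" and v0: "v \<noteq> 0\<^sub>v (n + n)" for v
    proof -
      obtain p q where p: "p \<in> carrier_vec n" and q: "q \<in> carrier_vec n" and v_eq: "v = p @\<^sub>v q"
        using v by (metis vec_first_carrier vec_first_last_append vec_last_carrier)
      have r: "q + ?Ft *\<^sub>v p \<in> carrier_vec n" using Ft p q by simp
      show ?thesis
      \<comment> \<open>For \<open>p = 0\<close> the square is the form of \<open>S\<close> at the
        nonzero vector \<open>q\<close>; otherwise the form of the complement is already positive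
        and the square is nonnegative.\<close>
      proof (cases "p = 0\<^sub>v n")
        case True
        then have "q \<noteq> 0\<^sub>v n" using v0 append_0[OF p q] v_eq by simp
        then have "0 < q \<bullet> (S *\<^sub>v q)" using pd q unfolding pos_def_mat_iff[OF S] by blast
        then show ?thesis unfolding v_eq square[OF sym p q] using True q Ft_0 L by simp
      next
        case False
        then have "0 < p \<bullet> (?L *\<^sub>v p)" using pd p unfolding pos_def_mat_iff[OF L] by blast
        then show ?thesis unfolding v_eq square[OF sym p q]
          using pos_def_mat_nonneg[OF _ S r] pd by simp
      qed
    qed
    then show "pos_def_mat ?M" unfolding pos_def_mat_iff[OF M] using symM sym by simp
  qed
qed

section \<open>From the Stein inequality to stability\<close>

text \<open>For an eigenvector \<open>w = a + i b\<close> of \<open>F^T\<close>, the Hermitian form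
  of \<open>S\<close> at \<open>w\<close> is the sum of the real forms at \<open>a\<close> and
  \<open>b\<close>. One step of \<open>F^T\<close> multiplies this sum by \<open>|z|^2\<close>,
  while the Stein inequality makes it strictly smaller.\<close>

lemma pos_def_stein_imp_eigenvalue_less_1:
  assumes F: "F \<in> carrier_mat n n" and S: "S \<in> carrier_mat n n"
    and pdS: "pos_def_mat S" and pdL: "pos_def_mat (S - F * S * transpose_mat F)"
    and ev: "eigenvalue (map_mat complex_of_real F) z"
  shows "cmod z < 1"
proof -
  let ?Ft = "transpose_mat F" and ?L = "S - F * S * transpose_mat F"
  define Q where "Q v = v \<bullet> (S *\<^sub>v v)" for v
  have Ft: "?Ft \<in> carrier_mat n n" and L: "?L \<in> carrier_mat n n"
    and Fc: "map_mat complex_of_real F \<in> carrier_mat n n"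
    and Ftc: "map_mat complex_of_real ?Ft \<in> carrier_mat n n"
    using F S by auto
  \<comment> \<open>The Stein form propagates vectors by \<open>F^T\<close>, so the eigenvalue is
    first carried over to the transpose, which has the same characteristic polynomial.\<close>
  have "map_mat complex_of_real ?Ft = transpose_mat (map_mat complex_of_real F)"
    by (rule eq_matI) auto
  then have "char_poly (map_mat complex_of_real ?Ft) = char_poly (map_mat complex_of_real F)"
    using char_poly_transpose_mat[OF Fc] by simp
  then have "eigenvalue (map_mat complex_of_real ?Ft) z"
    using ev unfolding eigenvalue_root_char_poly[OF Ftc] eigenvalue_root_char_poly[OF Fc] by simp
  then obtain w where w: "w \<in> carrier_vec n" "w \<noteq> 0\<^sub>v n"
    and eigen: "map_mat complex_of_real ?Ft *\<^sub>v w = z \<cdot>\<^sub>v w"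
    using Ft by (auto simp: eigenvalue_def eigenvector_def)
  define a b where "a = map_vec Re w" and "b = map_vec Im w"
  have a: "a \<in> carrier_vec n" and b: "b \<in> carrier_vec n" using w by (auto simp: a_def b_def)
  have eigen_nth: "(\<Sum>j = 0..<n. complex_of_real (F $$ (j, i)) * w $ j) = z * w $ i" if "i < n" for i
    using arg_cong[OF eigen, of "\<lambda>v. v $ i"] that w F by (simp add: scalar_prod_def)
  have Re_part: "?Ft *\<^sub>v a = Re z \<cdot>\<^sub>v a - Im z \<cdot>\<^sub>v b"
  proof (rule eq_vecI)
    fix i assume "i < dim_vec (Re z \<cdot>\<^sub>v a - Im z \<cdot>\<^sub>v b)"
    then have i: "i < n" using b by simp
    then show "(?Ft *\<^sub>v a) $ i = (Re z \<cdot>\<^sub>v a - Im z \<cdot>\<^sub>v b) $ i"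
      using arg_cong[OF eigen_nth[OF i], of Re] F w by (simp add: scalar_prod_def a_def b_def)
  qed (use F b in auto)
  have Im_part: "?Ft *\<^sub>v b = Im z \<cdot>\<^sub>v a + Re z \<cdot>\<^sub>v b"
  proof (rule eq_vecI)
    fix i assume "i < dim_vec (Im z \<cdot>\<^sub>v a + Re z \<cdot>\<^sub>v b)"
    then have i: "i < n" using b by simp
    then show "(?Ft *\<^sub>v b) $ i = (Im z \<cdot>\<^sub>v a + Re z \<cdot>\<^sub>v b) $ i"
      using arg_cong[OF eigen_nth[OF i], of Im] F w by (simp add: scalar_prod_def a_def b_def)
  qed (use F b in auto)
  have Q_lincomb: "Q (c \<cdot>\<^sub>v a + d \<cdot>\<^sub>v b) =
      c\<^sup>2 * Q a + c * d * (a \<bullet> (S *\<^sub>v b) + b \<bullet> (S *\<^sub>v a)) + d\<^sup>2 * Q b" for c d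
    using S a b unfolding Q_def
    by (simp add: mult_add_distrib_mat_vec[of _ n n] mult_mat_vec[of _ n n]
        scalar_prod_add_distrib[of _ n] add_scalar_prod_distrib[of _ n] power2_eq_square algebra_simps)
  \<comment> \<open>The mixed terms of the two forms carry the coefficients
    \<open>- Re z * Im z\<close> and \<open>Im z * Re z\<close>, so they cancel in the sum.\<close>
  have "Re z \<cdot>\<^sub>v a - Im z \<cdot>\<^sub>v b = Re z \<cdot>\<^sub>v a + (- Im z) \<cdot>\<^sub>v b"
    using a b by (intro eq_vecI) auto
  then have image: "Q (?Ft *\<^sub>v a) + Q (?Ft *\<^sub>v b) = (cmod z)\<^sup>2 * (Q a + Q b)"
    unfolding Re_part Im_part by (simp add: Q_lincomb cmod_power2 algebra_simps)
  have L_form: "v \<bullet> (?L *\<^sub>v v) = Q v - Q (?Ft *\<^sub>v v)" if v: "v \<in> carrier_vec n" for v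
    unfolding Q_def by (rule quadratic_form_stein[OF F S v])
  have nonzero: "a \<noteq> 0\<^sub>v n \<or> b \<noteq> 0\<^sub>v n"
  proof (rule ccontr)
    assume "\<not> (a \<noteq> 0\<^sub>v n \<or> b \<noteq> 0\<^sub>v n)"
    then have zero: "map_vec Re w = 0\<^sub>v n" "map_vec Im w = 0\<^sub>v n" by (auto simp: a_def b_def)
    have "w = 0\<^sub>v n"
    proof (rule eq_vecI)
      fix i assume "i < dim_vec (0\<^sub>v n :: complex vec)"
      then show "w $ i = 0\<^sub>v n $ i"
        using arg_cong[OF zero(1), of "\<lambda>v. v $ i"] arg_cong[OF zero(2), of "\<lambda>v. v $ i"] w
        by (simp add: complex_eq_iff)
    qed (use w in auto)
    with w show False by simp
  qed
  \<comment> \<open>Used twice: for the Stein matrix it gives the strict decrease, for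
    \<open>S\<close> the positive factor to be cancelled.\<close>
  have sum_pos: "0 < a \<bullet> (M *\<^sub>v a) + b \<bullet> (M *\<^sub>v b)"
    if M: "M \<in> carrier_mat n n" and pd: "pos_def_mat M" for M
    using nonzero
  proof
    assume "a \<noteq> 0\<^sub>v n"
    then show ?thesis
      using pd a pos_def_mat_nonneg[OF pd M b] unfolding pos_def_mat_iff[OF M]
      by (intro add_pos_nonneg) blast+
  next
    assume "b \<noteq> 0\<^sub>v n"
    then show ?thesis
      using pd b pos_def_mat_nonneg[OF pd M a] unfolding pos_def_mat_iff[OF M]
      by (intro add_nonneg_pos) blast+
  qed
  have "(cmod z)\<^sup>2 * (Q a + Q b) < 1 * (Q a + Q b)"
    using sum_pos[OF L pdL] image by (simp add: L_form[OF a] L_form[OF b])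
  moreover have "0 < Q a + Q b" using sum_pos[OF S pdS] by (simp add: Q_def)
  ultimately have "(cmod z)\<^sup>2 < 1" by (metis mult_less_cancel_right_pos)
  then show ?thesis using power2_less_imp_less[of "cmod z" 1] by simp
qed

section \<open>Decay of the powers of a stable matrix\<close>

lemma smult_pow_mat:
  fixes A :: "'a :: comm_semiring_1 mat"
  assumes A: "A \<in> carrier_mat n n"
  shows "(c \<cdot>\<^sub>m A) ^\<^sub>m k = c ^ k \<cdot>\<^sub>m (A ^\<^sub>m k)"
proof (induction k)
  case (Suc k)
  have Ak: "A ^\<^sub>m k \<in> carrier_mat n n" using A by simp
  then show ?case using Suc A
    by (auto simp: mult_smult_assoc_mat[OF Ak A] mult_smult_distrib[of _ n n _ n] ac_simps
        intro!: eq_matI)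
qed (use A in \<open>auto intro!: eq_matI\<close>)

lemma eigenvalue_smult:
  fixes A :: "'a :: field mat"
  assumes A: "A \<in> carrier_mat n n" and c: "c \<noteq> 0" and ev: "eigenvalue (c \<cdot>\<^sub>m A) z"
  shows "eigenvalue A (z / c)"
proof -
  obtain v where v: "v \<in> carrier_vec n" "v \<noteq> 0\<^sub>v n" and eq: "(c \<cdot>\<^sub>m A) *\<^sub>v v = z \<cdot>\<^sub>v v"
    using ev A by (auto simp: eigenvalue_def eigenvector_def)
  have "A *\<^sub>v v = (z / c) \<cdot>\<^sub>v v"
  proof (rule eq_vecI)
    fix i assume "i < dim_vec ((z / c) \<cdot>\<^sub>v v)"
    then have i: "i < n" using v by simp
    then have "c * (A *\<^sub>v v) $ i = z * v $ i"
      using arg_cong[OF eq, of "\<lambda>v. v $ i"] A v by simp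
    then show "(A *\<^sub>v v) $ i = ((z / c) \<cdot>\<^sub>v v) $ i"
      using i v c by (simp add: field_simps)
  qed (use A v in auto)
  then show ?thesis using A v by (auto simp: eigenvalue_def eigenvector_def)
qed

text \<open>Dividing \<open>F\<close> by some \<open>r\<close> between its spectral radius and 1
  leaves a spectral radius below 1, so the entries of the rescaled powers are bounded by a constant
  \<open>c\<close>, and those of \<open>F ^ k\<close> by \<open>c * r ^ k\<close>. The exponent
  \<open>Suc k\<close> matches the remainder of the partial sums below.\<close>

lemma stable_mat_power_small:
  fixes F :: "real mat"
  assumes F: "F \<in> carrier_mat n n"
    and stable: "\<And>z. eigenvalue (map_mat complex_of_real F) z \<Longrightarrow> cmod z < 1"
    and e: "e > 0"
  obtains k where "\<And>i j. i < n \<Longrightarrow> j < n \<Longrightarrow> \<bar>(F ^\<^sub>m Suc k) $$ (i, j)\<bar> < e"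
proof (cases "n = 0")
  \<comment> \<open>In dimension 0 there is no eigenvalue to attain the spectral radius, but the
    entry bound is vacuous.\<close>
  case True
  then show ?thesis using that by blast
next
  case False
  let ?Fc = "map_mat complex_of_real F"
  have Fc: "?Fc \<in> carrier_mat n n" using F by simp
  have "spectral_radius ?Fc < 1"
    using spectral_radius_mem_max(1)[OF Fc] False stable by (auto simp: spectrum_def)
  moreover have "0 \<le> spectral_radius ?Fc"
    using spectral_radius_mem_max(1)[OF Fc] False by auto
  ultimately obtain r where r: "spectral_radius ?Fc < r" "r < 1" "0 < r"
    using dense by (metis le_less_trans)
  define G where "G = complex_of_real (inverse r) \<cdot>\<^sub>m ?Fc"
  have G: "G \<in> carrier_mat n n" using Fc by (simp add: G_def)
  have "spectral_radius G < 1"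
  proof -
    obtain z where z: "eigenvalue G z" "spectral_radius G = cmod z"
      using spectral_radius_mem_max(1)[OF G] False by (auto simp: spectrum_def)
    \<comment> \<open>Undoing the scaling turns \<open>z\<close> into the eigenvalue
      \<open>z * r\<close> of \<open>F\<close>, whose modulus is below \<open>r\<close>.\<close>
    then have "eigenvalue ?Fc (z / complex_of_real (inverse r))"
      using r eigenvalue_smult[OF Fc] by (simp add: G_def)
    then have "cmod (z / complex_of_real (inverse r)) \<le> spectral_radius ?Fc"
      using spectral_radius_mem_max(2)[OF Fc] False by (auto simp: spectrum_def)
    also have "cmod (z / complex_of_real (inverse r)) = cmod z * r"
      using r by (simp add: norm_divide norm_mult norm_inverse field_simps)
    finally have "cmod z * r < 1 * r" using r(1) by linarith
    then show ?thesis using r(3) z(2) by (simp only: mult_less_cancel_right_pos)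
  qed
  \<comment> \<open>A spectral radius below 1 bounds the entries of all powers uniformly in the
    exponent.\<close>
  then obtain c where c: "\<And>k. norm_bound (G ^\<^sub>m k) c"
    using spectral_radius_jnf_norm_bound_less_1_upper_triangular[OF G] by blast
  have bound: "\<bar>(F ^\<^sub>m k) $$ (i, j)\<bar> \<le> c * r ^ k" if ij: "i < n" "j < n" for i j k
  proof -
    have Fk: "F ^\<^sub>m k \<in> carrier_mat n n" using F by simp
    have "G ^\<^sub>m k = complex_of_real (inverse r) ^ k \<cdot>\<^sub>m map_mat complex_of_real (F ^\<^sub>m k)"
      unfolding G_def smult_pow_mat[OF Fc] of_real_hom.mat_hom_pow[OF F] ..
    then have "(G ^\<^sub>m k) $$ (i, j) =
        complex_of_real (inverse r) ^ k * complex_of_real ((F ^\<^sub>m k) $$ (i, j))"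
      using ij carrier_matD[OF Fk] by (simp del: pow_mat_dim)
    moreover have "cmod ((G ^\<^sub>m k) $$ (i, j)) \<le> c"
      using c[of k] ij G unfolding norm_bound_def by simp
    ultimately have "inverse r ^ k * \<bar>(F ^\<^sub>m k) $$ (i, j)\<bar> \<le> c"
      using r by (simp add: norm_mult norm_power norm_inverse)
    then show ?thesis using r by (simp add: field_simps power_inverse)
  qed
  have "(\<lambda>k. c * r ^ Suc k) \<longlonglongrightarrow> c * 0"
    using r by (intro tendsto_mult tendsto_const LIMSEQ_Suc LIMSEQ_realpow_zero) auto
  then have "\<forall>\<^sub>F k in sequentially. c * r ^ Suc k < e"
    using e by (intro order_tendstoD) auto
  then obtain k where "c * r ^ Suc k < e" by (auto simp: eventually_sequentially)
  with bound[of _ _ "Suc k"] show ?thesis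
    by (intro that[of k]) (meson le_less_trans)
qed

section \<open>Solving the Stein inequality for a stable matrix\<close>

text \<open>Entries this small make \<open>G^T\<close> shrink the Euclidean norm: summing
  \<open>n\<close> entries bounds each coordinate of \<open>G^T v\<close> by
  \<open>c = n / (n + 1)^2\<close> times the norm of \<open>v\<close>, and summing \<open>n\<close>
  coordinates leaves \<open>n * c^2 < 1\<close>. The \<open>+ 1\<close> keeps the threshold positive
  for \<open>n = 0\<close>.\<close>

lemma pos_def_one_minus_gram:
  fixes G :: "real mat"
  assumes G: "G \<in> carrier_mat n n"
    and small: "\<And>i j. i < n \<Longrightarrow> j < n \<Longrightarrow> \<bar>G $$ (i, j)\<bar> < 1 / (real n + 1)\<^sup>2"
  shows "pos_def_mat (1\<^sub>m n - G * transpose_mat G)" (is "pos_def_mat ?L")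
proof -
  have L: "?L \<in> carrier_mat n n" using G by (intro minus_carrier_mat mult_carrier_mat[of _ n n]) auto
  \<comment> \<open>Inserting the identity in the role of \<open>S\<close> makes the congruence and
    Stein lemmas applicable.\<close>
  have L_eq: "?L = 1\<^sub>m n - G * 1\<^sub>m n * transpose_mat G" using G by simp
  have "transpose_mat ?L = ?L"
    unfolding L_eq using transpose_congruence[OF G one_carrier_mat transpose_one] G
    by (subst transpose_minus[of _ n n]) auto
  moreover have "0 < v \<bullet> (?L *\<^sub>v v)" if v: "v \<in> carrier_vec n" "v \<noteq> 0\<^sub>v n" for v
  proof -
    define g where "g = transpose_mat G *\<^sub>v v"
    have g: "g \<in> carrier_vec n" using G v by (simp add: g_def)
    have v_pos: "0 < v \<bullet> v"
      using pos_def_mat_one v unfolding pos_def_mat_iff[OF one_carrier_mat] by fastforce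
    have v_le: "\<bar>v $ j\<bar> \<le> sqrt (v \<bullet> v)" if "j < n" for j
    proof -
      have "(v $ j)\<^sup>2 \<le> (\<Sum>j = 0..<n. (v $ j)\<^sup>2)"
        using that by (intro member_le_sum) auto
      then show ?thesis
        using v by (intro real_le_rsqrt) (simp add: scalar_prod_def power2_eq_square)
    qed
    define c where "c = real n / (real n + 1)\<^sup>2"
    have g_le: "(g $ i)\<^sup>2 \<le> c\<^sup>2 * (v \<bullet> v)" if i: "i < n" for i
    proof -
      have "\<bar>g $ i\<bar> = \<bar>\<Sum>j = 0..<n. G $$ (j, i) * v $ j\<bar>"
        using G v i by (simp add: g_def scalar_prod_def)
      also have "\<dots> \<le> (\<Sum>j = 0..<n. 1 / (real n + 1)\<^sup>2 * sqrt (v \<bullet> v))"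
      proof (rule order.trans[OF sum_abs], rule sum_mono)
        fix j assume "j \<in> {0..<n}"
        then have "j < n" by simp
        then show "\<bar>G $$ (j, i) * v $ j\<bar> \<le> 1 / (real n + 1)\<^sup>2 * sqrt (v \<bullet> v)"
          using small[of j i] i v_le[of j] by (auto simp only: abs_mult intro!: mult_mono) auto
      qed
      finally have "\<bar>g $ i\<bar> \<le> c * sqrt (v \<bullet> v)" by (simp add: c_def)
      then have "\<bar>g $ i\<bar>\<^sup>2 \<le> (c * sqrt (v \<bullet> v))\<^sup>2" by (rule power_mono) simp
      then show ?thesis using v_pos by (simp add: power_mult_distrib)
    qed
    have "g \<bullet> g = (\<Sum>i = 0..<n. (g $ i)\<^sup>2)"
      using g by (simp add: scalar_prod_def power2_eq_square)
    also have "\<dots> \<le> (\<Sum>i = 0..<n. c\<^sup>2 * (v \<bullet> v))"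
      using g_le by (intro sum_mono) auto
    also have "\<dots> = (real n * c\<^sup>2) * (v \<bullet> v)" by simp
    also have "real n * c\<^sup>2 < 1"
    proof -
      \<comment> \<open>\<open>real n * c^2\<close> equals \<open>n^3 / (n + 1)^4\<close>.\<close>
      have "real n ^ 3 < (real n + 1) ^ 4"
        by (rule less_le_trans[of _ "(real n + 1) ^ 3"]) (auto intro!: power_strict_mono power_increasing)
      then show ?thesis
        by (simp add: c_def power_divide power_mult[symmetric] divide_simps power2_eq_square
            power3_eq_cube power4_eq_xxxx mult.assoc)
    qed
    then have "(real n * c\<^sup>2) * (v \<bullet> v) < 1 * (v \<bullet> v)"
      using v_pos by (rule mult_strict_right_mono)
    finally have "g \<bullet> g < v \<bullet> v" by simp
    moreover have "v \<bullet> (?L *\<^sub>v v) = v \<bullet> v - g \<bullet> g"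
      using quadratic_form_stein[OF G one_carrier_mat v(1)] v(1) g
      unfolding L_eq g_def[symmetric] by simp
    ultimately show ?thesis by simp
  qed
  ultimately show ?thesis by (simp add: pos_def_mat_iff[OF L])
qed

text \<open>The power recursion multiplies on the right, whereas congruence by \<open>F\<close>
  attaches the new factor on the left.\<close>

lemma pow_mat_Suc_left:
  fixes A :: "'a :: semiring_1 mat"
  assumes A: "A \<in> carrier_mat n n"
  shows "A ^\<^sub>m Suc k = A * A ^\<^sub>m k"
proof (induction k)
  case (Suc k)
  then show ?case using A by (simp add: assoc_mult_mat[of _ n n _ n _ n])
qed (use A in simp)

text \<open>The partial sums of \<open>\<Sum>i. F ^ i * (F\<^sup>T) ^ i\<close>, which solve the Stein equation up to
  the remainder \<open>F ^ (k + 1) * (F\<^sup>T) ^ (k + 1)\<close>.\<close>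

lemma stein_partial_sum:
  fixes F :: "real mat"
  assumes F: "F \<in> carrier_mat n n"
  shows "\<exists>S \<in> carrier_mat n n. pos_def_mat S \<and>
    S - F * S * transpose_mat F = 1\<^sub>m n - F ^\<^sub>m Suc k * transpose_mat (F ^\<^sub>m Suc k)"
proof (induction k)
  case 0
  show ?case using F pos_def_mat_one by (intro bexI[of _ "1\<^sub>m n"]) auto
next
  case (Suc k)
  then obtain S where S: "S \<in> carrier_mat n n" and pd: "pos_def_mat S"
    and eq: "S - F * S * transpose_mat F = 1\<^sub>m n - F ^\<^sub>m Suc k * transpose_mat (F ^\<^sub>m Suc k)"
    by blast
  define C where "C X = F * X * transpose_mat F" for X
  define G where "G = F ^\<^sub>m Suc k"
  have Ft: "transpose_mat F \<in> carrier_mat n n" using F by simp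
  have G: "G \<in> carrier_mat n n" unfolding G_def using F by (intro pow_carrier_mat)
  have C: "C X \<in> carrier_mat n n" if "X \<in> carrier_mat n n" for X
    using that F by (simp add: C_def)
  have C_add: "C (X + Y) = C X + C Y" and C_minus: "C (X - Y) = C X - C Y"
    if "X \<in> carrier_mat n n" "Y \<in> carrier_mat n n" for X Y
    using that F Ft
    by (simp_all add: C_def mult_add_distrib_mat[of _ n n] add_mult_distrib_mat[of _ n n]
        mult_minus_distrib_mat[of _ n n] minus_mult_distrib_mat[of _ n n])
  have GG: "G * transpose_mat G \<in> carrier_mat n n" using G by simp
  have "C (G * transpose_mat G) = (F * G) * transpose_mat (F * G)"
    using F G by (simp add: C_def transpose_mult[of _ n n] assoc_mult_mat[of _ n n _ n _ n])
  also have "F * G = F ^\<^sub>m Suc (Suc k)"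
    unfolding G_def by (rule pow_mat_Suc_left[OF F, symmetric])
  finally have C_GG: "C (G * transpose_mat G) = F ^\<^sub>m Suc (Suc k) * transpose_mat (F ^\<^sub>m Suc (Suc k))" .
  \<comment> \<open>The induction hypothesis solved for \<open>C S\<close>, so that \<open>C\<close>
    can be applied to it once more.\<close>
  have CS: "C S = S - (1\<^sub>m n - G * transpose_mat G)"
  proof (rule eq_matI)
    fix i j
    assume "i < dim_row (S - (1\<^sub>m n - G * transpose_mat G))"
      "j < dim_col (S - (1\<^sub>m n - G * transpose_mat G))"
    then have "i < n" "j < n" using G by auto
    then show "C S $$ (i, j) = (S - (1\<^sub>m n - G * transpose_mat G)) $$ (i, j)"
      using arg_cong[OF eq, of "\<lambda>M. M $$ (i, j)", folded C_def G_def] S C[OF S] GG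
      by (simp del: index_mult_mat)
  qed (use C[OF S] GG in auto)
  \<comment> \<open>Congruence by \<open>F\<close> shifts every summand of a partial sum to the next
    power; adding the identity restores the summand for \<open>i = 0\<close>.\<close>
  let ?S = "1\<^sub>m n + C S"
  have S': "?S \<in> carrier_mat n n" using C[OF S] by simp
  have sym: "transpose_mat S = S" using pd by (simp add: pos_def_mat_def)
  have "transpose_mat ?S = ?S"
    using transpose_congruence[OF F S sym] C[OF S]
    by (subst transpose_add[of _ n n]) (auto simp: C_def)
  \<comment> \<open>Strictness comes from the identity; \<open>C S\<close> is only semidefinite when
    \<open>F\<close> is singular.\<close>
  moreover have "0 < v \<bullet> (?S *\<^sub>v v)" if v: "v \<in> carrier_vec n" "v \<noteq> 0\<^sub>v n" for v
  proof -
    have "0 < v \<bullet> v"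
      using pos_def_mat_one v unfolding pos_def_mat_iff[OF one_carrier_mat] by fastforce
    moreover have "0 \<le> v \<bullet> (C S *\<^sub>v v)"
      using quadratic_form_congruence[OF F S v(1)] pos_def_mat_nonneg[OF pd S] Ft v
      by (simp add: C_def)
    moreover have "v \<bullet> (?S *\<^sub>v v) = v \<bullet> v + v \<bullet> (C S *\<^sub>v v)"
      using v C[OF S]
      by (simp add: add_mult_distrib_mat_vec[of _ n n] scalar_prod_add_distrib[of _ n]
          mult_mat_vec_carrier[of _ n n])
    ultimately show ?thesis by simp
  qed
  ultimately have "pos_def_mat ?S" by (simp add: pos_def_mat_iff[OF S'])
  moreover have "?S - F * ?S * transpose_mat F =
      1\<^sub>m n - F ^\<^sub>m Suc (Suc k) * transpose_mat (F ^\<^sub>m Suc (Suc k))"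
  proof -
    have H: "1\<^sub>m n - G * transpose_mat G \<in> carrier_mat n n" by (rule minus_carrier_mat[OF GG])
    \<comment> \<open>By linearity of \<open>C\<close> the two occurrences of
      \<open>C (1\<^sub>m n)\<close> cancel, and only the remainder moves on to the next
      power.\<close>
    have "C ?S = C (1\<^sub>m n) + C (C S)" by (rule C_add[OF one_carrier_mat C[OF S]])
    also have "C (C S) = C S - C (1\<^sub>m n - G * transpose_mat G)"
      using arg_cong[OF CS, of C] C_minus[OF S H] by (rule trans)
    also have "C (1\<^sub>m n - G * transpose_mat G) = C (1\<^sub>m n) - C (G * transpose_mat G)"
      by (rule C_minus[OF one_carrier_mat GG])
    finally have "C ?S = C (1\<^sub>m n) + (C S - (C (1\<^sub>m n) - C (G * transpose_mat G)))" .
    then have "?S - C ?S = 1\<^sub>m n - C (G * transpose_mat G)"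
      using C[OF S] C[OF GG] C[OF one_carrier_mat] S by (intro eq_matI) auto
    then show ?thesis by (simp only: C_GG) (simp only: C_def)
  qed
  ultimately show ?case using S' by blast
qed

text \<open>Some power \<open>F ^ (k + 1)\<close> has entries below the threshold that makes the
  identity minus its Gram matrix positive definite, so a finite partial sum already solves the
  strict inequality.\<close>

lemma stable_imp_stein_solution:
  fixes F :: "real mat"
  assumes F: "F \<in> carrier_mat n n"
    and stable: "\<And>z. eigenvalue (map_mat complex_of_real F) z \<Longrightarrow> cmod z < 1"
  obtains S where "S \<in> carrier_mat n n" "pos_def_mat S" "pos_def_mat (S - F * S * transpose_mat F)"
proof -
  obtain k where small: "\<And>i j. i < n \<Longrightarrow> j < n \<Longrightarrow> \<bar>(F ^\<^sub>m Suc k) $$ (i, j)\<bar> < 1 / (real n + 1)\<^sup>2"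
    using stable_mat_power_small[OF F stable, of "1 / (real n + 1)\<^sup>2"] by auto
  obtain S where "S \<in> carrier_mat n n" "pos_def_mat S"
    "S - F * S * transpose_mat F = 1\<^sub>m n - F ^\<^sub>m Suc k * transpose_mat (F ^\<^sub>m Suc k)"
    using stein_partial_sum[OF F] by blast
  with that pos_def_one_minus_gram[OF pow_carrier_mat[OF F] small] show thesis by metis
qed

section \<open>Linear systems with full row rank\<close>

text \<open>A maximal independent set of columns has \<open>n\<close> members, hence is a basis, and
  the column space is the whole space.\<close>

lemma (in vec_space) full_row_rank_solvable:
  assumes M: "M \<in> carrier_mat n nc" and rank: "rank M = n" and y: "y \<in> carrier_vec n"
  obtains x where "x \<in> carrier_vec nc" "M *\<^sub>v x = y"
proof -
  have cols: "set (cols M) \<subseteq> carrier_vec n" using cols_dim M by blast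
  have "lin_indpt {}" by (simp add: lin_dep_def)
  then obtain I where I: "maximal I (\<lambda>J. J \<subseteq> set (cols M) \<and> lin_indpt J)" and "finite I"
    using maximal_exists_superset[of "set (cols M)" "\<lambda>J. J \<subseteq> set (cols M) \<and> lin_indpt J" "{}"]
    by auto
  then have I_cols: "I \<subseteq> set (cols M)" and "lin_indpt I" by (auto simp: maximal_def)
  moreover have "card I = n" using rank_card_indpt[OF M I] rank by simp
  ultimately have "basis I"
    using \<open>finite I\<close> cols by (intro dim_li_is_basis) (auto simp: dim_is_n)
  then have "span I = carrier_vec n" by (simp add: basis_def)
  then have "y \<in> col_space M"
    using span_is_monotone[OF I_cols] y by (auto simp: col_space_def)
  then show thesis using that M unfolding col_space_eq[OF M] by auto
qed

text \<open>Stacking turns the two matrix equations into one system with full row rank, which is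
  solved column by column.\<close>

lemma full_row_rank_append_rows_solvable:
  fixes M N :: "'a :: field mat"
  assumes M: "M \<in> carrier_mat m t" and N: "N \<in> carrier_mat n t"
    and rank: "vec_space.rank (m + n) (M @\<^sub>r N) = m + n"
    and Y: "Y \<in> carrier_mat m k" and Z: "Z \<in> carrier_mat n k"
  obtains Q where "Q \<in> carrier_mat t k" "M * Q = Y" "N * Q = Z"
proof -
  \<comment> \<open>Claimed for every \<open>j\<close>: \<open>col\<close> has the right length even
    beyond the last column, so the choice of \<open>q\<close> carries no range condition.\<close>
  have "\<exists>q \<in> carrier_vec t. M *\<^sub>v q = col Y j \<and> N *\<^sub>v q = col Z j" for j
  proof -
    have y: "col Y j \<in> carrier_vec m" and z: "col Z j \<in> carrier_vec n" using Y Z by auto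
    obtain q where q: "q \<in> carrier_vec t" and eq: "(M @\<^sub>r N) *\<^sub>v q = col Y j @\<^sub>v col Z j"
      using vec_space.full_row_rank_solvable[OF carrier_append_rows[OF M N] rank
          append_carrier_vec[OF y z]] by blast
    have "M *\<^sub>v q = col Y j \<and> N *\<^sub>v q = col Z j"
      using eq append_vec_eq[OF mult_mat_vec_carrier[OF M q] y]
      unfolding mat_mult_append[OF M N q] by blast
    with q show ?thesis by blast
  qed
  then obtain q where q: "\<And>j. q j \<in> carrier_vec t" "\<And>j. M *\<^sub>v q j = col Y j"
    "\<And>j. N *\<^sub>v q j = col Z j"
    by metis
  define Q where "Q = mat_of_cols t (map q [0..<k])"
  have Q: "Q \<in> carrier_mat t k"
    using mat_of_cols_carrier(1)[of t "map q [0..<k]"] by (simp add: Q_def)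
  have col_Q: "col Q j = q j" if "j < k" for j
    using that q by (simp add: Q_def)
  have "M * Q = Y"
  proof (rule mat_col_eqI)
    fix j assume "j < dim_col Y"
    then have j: "j < k" using Y by simp
    show "col (M * Q) j = col Y j" unfolding col_mult2[OF M Q j] col_Q[OF j] by (simp add: q)
  qed (use M Q Y in auto)
  moreover have "N * Q = Z"
  proof (rule mat_col_eqI)
    fix j assume "j < dim_col Z"
    then have j: "j < k" using Z by simp
    show "col (N * Q) j = col Z j" unfolding col_mult2[OF N Q j] col_Q[OF j] by (simp add: q)
  qed (use N Q Z in auto)
  ultimately show thesis using that Q by blast
qed

section \<open>Data matrices and the characterization of stabilizing gains\<close>

lemma data_mat_carrier: "data_mat d z i T \<in> carrier_mat d T"
  using mat_of_cols_carrier(1)[of d "map z [i..<i + T]"] by (simp add: data_mat_def)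

lemma col_data_mat:
  assumes "j < T" and "z (i + j) \<in> carrier_vec d"
  shows "col (data_mat d z i T) j = z (i + j)"
proof -
  have nth: "map z [i..<i + T] ! j = z (i + j)" using assms(1) by (subst nth_map) auto
  show ?thesis
    unfolding data_mat_def using assms nth by (subst col_mat_of_cols) simp_all
qed

text \<open>Invertibility of \<open>X0 * Q\<close> is part of the claim in both directions,
  expressed by \<open>mat_inverse\<close> returning \<open>Some P\<close>. The stacked matrix has
  \<open>m + n\<close> rows, so the rank condition means full row rank.\<close>

theorem theorem3:
  fixes A B U X0 X1 :: "real mat" and u x :: "nat \<Rightarrow> real vec" and n m T :: nat
  assumes A: "A \<in> carrier_mat n n"
    and B: "B \<in> carrier_mat n m"
    and controllable: "controllable A B"
    and u: "\<And>k. k < T \<Longrightarrow> u k \<in> carrier_vec m"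
    and x: "\<And>k. k \<le> T \<Longrightarrow> x k \<in> carrier_vec n"
    and data: "\<And>k. k < T \<Longrightarrow> x (Suc k) = A *\<^sub>v x k + B *\<^sub>v u k"
    and U: "U = data_mat m u 0 T"
    and X0: "X0 = data_mat n x 0 T"
    and X1: "X1 = data_mat n x 1 T"
    and rank: "vec_space.rank (m + n) (U @\<^sub>r X0) = n + m"
  shows "(\<forall>Q \<in> carrier_mat T n. data_lmi X0 X1 Q \<longrightarrow>
            (\<exists>P. mat_inverse (X0 * Q) = Some P \<and> stabilizing A B (U * Q * P))) \<and>
         (\<forall>K \<in> carrier_mat m n. stabilizing A B K \<longrightarrow>
            (\<exists>Q \<in> carrier_mat T n. data_lmi X0 X1 Q \<and>
               (\<exists>P. mat_inverse (X0 * Q) = Some P \<and> K = U * Q * P)))"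
proof -
  have X0': "X0 \<in> carrier_mat n T" and X1': "X1 \<in> carrier_mat n T" and U': "U \<in> carrier_mat m T"
    unfolding X0 X1 U by (rule data_mat_carrier)+
  have cols: "col X0 j = x j" "col X1 j = x (Suc j)" "col U j = u j" if "j < T" for j
    using that u x unfolding X0 X1 U by (simp_all add: col_data_mat)
  \<comment> \<open>Column \<open>j\<close> of \<open>X1\<close> is the successor of column
    \<open>j\<close> of \<open>X0\<close>, so the data equations combine into one matrix
    identity.\<close>
  have dynamics: "X1 = A * X0 + B * U"
  proof (rule mat_col_eqI)
    fix j assume "j < dim_col (A * X0 + B * U)"
    then have j: "j < T" using U' by simp
    have "col (A * X0 + B * U) j = A *\<^sub>v col X0 j + B *\<^sub>v col U j"
      using j col_mult2[OF A X0' j] col_mult2[OF B U' j] A B X0' U' by (subst col_add[of _ n T]) auto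
    then show "col X1 j = col (A * X0 + B * U) j" using j data by (simp add: cols)
  qed (use A B X1' U' in auto)
  have X1Q: "X1 * Q = A * (X0 * Q) + B * (U * Q)" if Q: "Q \<in> carrier_mat T n" for Q
    unfolding dynamics using A B X0' U' Q
    by (simp add: add_mult_distrib_mat[of _ n T _ _ n] assoc_mult_mat[of _ n n _ T _ n]
        assoc_mult_mat[of _ n m _ T _ n])
  have lmi: "data_lmi X0 X1 Q \<longleftrightarrow>
      pos_def_mat (four_block_mat (X0 * Q) (X1 * Q) (transpose_mat (X1 * Q)) (X0 * Q))"
    if "Q \<in> carrier_mat T n" for Q
    using transpose_mult[OF X1' that] by (simp add: data_lmi_def)
  have "\<exists>P. mat_inverse (X0 * Q) = Some P \<and> stabilizing A B (U * Q * P)"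
    if Q: "Q \<in> carrier_mat T n" and "data_lmi X0 X1 Q" for Q
  proof -
    let ?S = "X0 * Q"
    have S: "?S \<in> carrier_mat n n" and UQ: "U * Q \<in> carrier_mat m n"
      and E: "X1 * Q \<in> carrier_mat n n" "transpose_mat (X1 * Q) \<in> carrier_mat n n"
      using X0' X1' U' Q by auto
    have pd: "pos_def_mat (four_block_mat ?S (X1 * Q) (transpose_mat (X1 * Q)) ?S)"
      using that lmi by blast
    \<comment> \<open>The gain contains the inverse of \<open>?S\<close>, so definiteness of
      \<open>?S\<close> is extracted before the closed-loop matrix can be named.\<close>
    then have "pos_def_mat ?S" by (rule pos_def_mat_upper_left_block[OF S E S])
    then obtain P where P: "mat_inverse ?S = Some P" "P \<in> carrier_mat n n" "P * ?S = 1\<^sub>m n"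
      using pos_def_mat_imp_mat_inverse[OF S] by metis
    define F where "F = A + B * (U * Q * P)"
    have F: "F \<in> carrier_mat n n" using A B UQ P(2) by (simp add: F_def)
    \<comment> \<open>Multiplying by \<open>?S\<close> on the right cancels \<open>P\<close> and
      expresses the closed loop through the data, as \<open>F * ?S = X1 * Q\<close>.\<close>
    have "F * ?S = A * ?S + B * (U * Q * P) * ?S"
      unfolding F_def by (rule add_mult_distrib_mat[OF A _ S]) (use B UQ P(2) in auto)
    also have "B * (U * Q * P) * ?S = B * (U * Q * (P * ?S))"
      using assoc_mult_mat[OF B mult_carrier_mat[OF UQ P(2)] S] assoc_mult_mat[OF UQ P(2) S] by simp
    also have "\<dots> = B * (U * Q)" unfolding P(3) right_mult_one_mat[OF UQ] ..
    finally have "F * ?S = X1 * Q" using X1Q[OF Q] by simp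
    with pd have "pos_def_mat ?S \<and> pos_def_mat (?S - F * ?S * transpose_mat F)"
      using pos_def_block_mat_iff[OF F S] by simp
    then have "stabilizing A B (U * Q * P)"
      using pos_def_stein_imp_eigenvalue_less_1[OF F S] by (auto simp: stabilizing_def F_def)
    with P(1) show ?thesis by blast
  qed
  moreover have "\<exists>Q \<in> carrier_mat T n. data_lmi X0 X1 Q \<and>
      (\<exists>P. mat_inverse (X0 * Q) = Some P \<and> K = U * Q * P)"
    if K: "K \<in> carrier_mat m n" and stab: "stabilizing A B K" for K
  proof -
    define F where "F = A + B * K"
    have F: "F \<in> carrier_mat n n" using A B K by (simp add: F_def)
    obtain S where S: "S \<in> carrier_mat n n" and pd: "pos_def_mat S"
      "pos_def_mat (S - F * S * transpose_mat F)"
      using stable_imp_stein_solution[OF F] stab by (auto simp: stabilizing_def F_def)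
    have KS: "K * S \<in> carrier_mat m n" using K S by simp
    \<comment> \<open>The rank condition lets \<open>U * Q\<close> and \<open>X0 * Q\<close> be
      prescribed independently: \<open>S\<close> carries the stability certificate,
      \<open>K * S\<close> encodes the gain.\<close>
    obtain Q where Q: "Q \<in> carrier_mat T n" and UQ: "U * Q = K * S" and X0Q: "X0 * Q = S"
      using full_row_rank_append_rows_solvable[OF U' X0' _ KS S] rank by (metis add.commute)
    have "F * S = A * S + B * K * S"
      unfolding F_def by (rule add_mult_distrib_mat[OF A _ S]) (use B K in auto)
    then have "F * S = X1 * Q"
      unfolding X1Q[OF Q] UQ X0Q using assoc_mult_mat[OF B K S] by simp
    then have "data_lmi X0 X1 Q"
      using pos_def_block_mat_iff[OF F S] pd unfolding lmi[OF Q] X0Q by simp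
    moreover obtain P where P: "mat_inverse S = Some P" "P \<in> carrier_mat n n" "S * P = 1\<^sub>m n"
      using pos_def_mat_imp_mat_inverse[OF S pd(1)] by metis
    moreover have "K = U * Q * P"
      unfolding UQ using assoc_mult_mat[OF K S P(2)] P(3) K by simp
    ultimately show ?thesis using Q X0Q by blast
  qed
  ultimately show ?thesis by blast
qed

end
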